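(* Let $T$ be a discrete random variable and let $\preceq$ be any one of the following three preorders between random variables jointly distributed with $T$: the less noisy preorder $\preceq_{ln}$, the more capable preorder $\preceq_{mc}$, or the degradation/supermodularity preorder $\preceq_{ds}$. Then $\preceq$ satisfies Kolchinsky's axioms: for any discrete random variables $Y_1,\dots,Y_n$ with joint distribution $p(y_1,\dots,y_n,t)$, (i) for all $i,j$, $Y_i\preceq Y_j \Rightarrow I(Y_i;T)\le I(Y_j;T)$; (ii) $Y_i\preceq Y_i$ for all $i$; (iii) for every $i$, $C\preceq Y_i\preceq (Y_1,\dots,Y_n)$, where $C$ is any random variable taking a constant value with probability one.
   Context: All random variables take values in finite alphabets, and the alphabet $\mathcal T$ of $T$ is its support, so $p(t)>0$ for all $t\in\mathcal T$. $I(\cdot;\cdot)$ is Shannon's mutual information. A channel with input $T$ is a row-stochastic matrix $K$ with rows indexed by $\mathcal T$. A random variable $Y\in\mathcal Y$ jointly distributed with $T$ induces the channel $K^{Y}$, the $|\mathcal T|\times|\mathcal Y|$ matrix with $K^Y[t,y]=p(y|t)$. For each relation $\preceq$ between channels with input $T$, $Y_1\preceq Y_2$ means $K^{Y_1}\preceq K^{Y_2}$. Let $K^{(1)},K^{(2)}$ be channels with input $T$ and outputs $Y_1,Y_2$ respectively. Less noisy: $K^{(1)}\preceq_{ln}K^{(2)}$ if for any discrete random variable $U$ with finite support such that $U\to T\to Y_1$ and $U\to T\to Y_2$ are Markov chains, $I(U;Y_1)\le I(U;Y_2)$. This is a property of the channels only: $U$ and the input $T$ may have any joint distribution $p(u,t)$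 (the input marginal on $\mathcal T$ is not fixed), and $Y_i$ is generated from $T$ through $K^{(i)}$. ($X_1\to X_2\to X_3$ is a Markov chain if $X_1$ and $X_3$ are conditionally independent given $X_2$.) More capable: $K^{(1)}\preceq_{mc}K^{(2)}$ if for every probability distribution $p(t)$ on $\mathcal T$, $I(T;Y_1)\le I(T;Y_2)$, where $T\sim p(t)$ and $Y_i$ is generated from $T$ through $K^{(i)}$. Degradation: $K^{(1)}\preceq_d K^{(2)}$ if there is a row-stochastic matrix $K^U$ with $K^{(1)}=K^{(2)}K^U$. JoinMeet operator: for real vectors $r,s$ of the same dimension let $r\lor s$ and $r\land s$ be the componentwise maximum and minimum. For a channel $K$ with columns $K_l$ and indices $i\ne j$, $\diamond_{i,j}K$ is the channel whose $l$-th column is $K_i\lor K_j$ if $l=i$, $K_i\land K_j$ if $l=j$, and $K_l$ otherwise. Supermodularity: $W\preceq_s V$ if there is a finite collection of tuples $(i_k,j_k)$, $k=1,\dots,m$, such that $W=\diamond_{i_1,j_1}(\diamond_{i_2,j_2}(\cdots(\diamond_{i_m,j_m}V)))$. Degradation/supermodularity: $W\preceq_{ds}V$ if there are finitely many channels $U^{(1)},\dots,U^{(m)}$ with input $T$ such that $W\preceq_0U^{(1)}\preceq_1U^{(2)}\preceq_2\cdots\preceq_{m-1}U^{(m)}\preceq_mV$, where each $\preceq_i$ is $\preceq_d$ or $\preceq_s$. *)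

theory Defs
  imports "HOL-Probability.Probability" "Jordan_Normal_Form.Matrix"
begin

text \<open>
  A discrete random variable with finite alphabet on a probability space \<open>M\<close> is a
  \<^const>\<open>simple_function\<close>. For such variables the following is \<open>\<I>(X ; Y)\<close> of the locale
  \<^locale>\<open>information_space\<close>, with the base of the logarithm (> 1) and the space written explicitly.
\<close>

abbreviation mutual_info :: "real \<Rightarrow> 'a measure \<Rightarrow> ('a \<Rightarrow> 'x) \<Rightarrow> ('a \<Rightarrow> 'y) \<Rightarrow> real" where
  "mutual_info b M X Y \<equiv>
     prob_space.mutual_information M b (count_space (X ` space M)) (count_space (Y ` space M)) X Y"

definition markov_chain ::
    "'a measure \<Rightarrow> ('a \<Rightarrow> 'x) \<Rightarrow> ('a \<Rightarrow> 'y) \<Rightarrow> ('a \<Rightarrow> 'z) \<Rightarrow> bool" where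
  "markov_chain M X Y Z \<longleftrightarrow> (\<forall>x y z. \<P>(\<omega> in M. Y \<omega> = y) > 0 \<longrightarrow>
     \<P>(\<omega> in M. X \<omega> = x \<and> Z \<omega> = z \<bar> Y \<omega> = y)
       = \<P>(\<omega> in M. X \<omega> = x \<bar> Y \<omega> = y) * \<P>(\<omega> in M. Z \<omega> = z \<bar> Y \<omega> = y))"

text \<open>
  A channel is a row-stochastic matrix. Its rows and columns are indexed by initial segments of the
  naturals, which stand for enumerated input and output alphabets. This way channels with outputs
  of different types can be compared.
\<close>

definition row_stochastic :: "real mat \<Rightarrow> bool" where
  "row_stochastic K \<longleftrightarrow> (\<forall>i<dim_row K.
     (\<forall>j<dim_col K. 0 \<le> K $$ (i, j)) \<and> (\<Sum>j<dim_col K. K $$ (i, j)) = 1)"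

definition enumerates_support :: "'a measure \<Rightarrow> ('a \<Rightarrow> 't) \<Rightarrow> 't list \<Rightarrow> bool" where
  "enumerates_support M T ts \<longleftrightarrow> distinct ts \<and> set ts = {t. \<P>(\<omega> in M. T \<omega> = t) > 0}"

text \<open>Output alphabets, unlike the input alphabet, may contain symbols of probability zero.\<close>

definition enumerates_alphabet :: "'a measure \<Rightarrow> ('a \<Rightarrow> 'y) \<Rightarrow> 'y list \<Rightarrow> bool" where
  "enumerates_alphabet M Y ys \<longleftrightarrow> distinct ys \<and> (AE \<omega> in M. Y \<omega> \<in> set ys)"

definition induced_channel ::
    "'a measure \<Rightarrow> ('a \<Rightarrow> 't) \<Rightarrow> 't list \<Rightarrow> ('a \<Rightarrow> 'y) \<Rightarrow> 'y list \<Rightarrow> real mat" where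
  "induced_channel M T ts Y ys =
     Matrix.mat (length ts) (length ys) (\<lambda>(i, j). \<P>(\<omega> in M. Y \<omega> = ys ! j \<bar> T \<omega> = ts ! i))"

text \<open>\<open>Y\<close> is generated from \<open>T\<close> through \<open>K\<close>; the law of \<open>T\<close> on the row indices is arbitrary.\<close>

definition generated_through :: "'a measure \<Rightarrow> real mat \<Rightarrow> ('a \<Rightarrow> nat) \<Rightarrow> ('a \<Rightarrow> nat) \<Rightarrow> bool" where
  "generated_through M K T Y \<longleftrightarrow>
     simple_function M T \<and> T \<in> space M \<rightarrow> {..<dim_row K} \<and>
     simple_function M Y \<and> Y \<in> space M \<rightarrow> {..<dim_col K} \<and>
     (\<forall>t<dim_row K. \<forall>y<dim_col K. \<P>(\<omega> in M. T \<omega> = t) > 0 \<longrightarrow>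
        \<P>(\<omega> in M. Y \<omega> = y \<bar> T \<omega> = t) = K $$ (t, y))"

text \<open>
  The next two definitions quantify over all joint laws of finitely many finitely-valued variables.
  A definition cannot quantify over the type of the sample space, but the type \<open>nat\<close> suffices, since
  every such law is realised on a finite set of naturals; likewise \<open>U\<close> may be taken \<open>nat\<close>-valued.
\<close>

definition less_noisy :: "real \<Rightarrow> real mat \<Rightarrow> real mat \<Rightarrow> bool" where
  "less_noisy b K1 K2 \<longleftrightarrow> dim_row K1 = dim_row K2 \<and>
     (\<forall>(M :: nat measure) (U :: nat \<Rightarrow> nat) T Y1 Y2.
        prob_space M \<longrightarrow> simple_function M U \<longrightarrow>
        generated_through M K1 T Y1 \<longrightarrow> generated_through M K2 T Y2 \<longrightarrow>
        markov_chain M U T Y1 \<longrightarrow> markov_chain M U T Y2 \<longrightarrow>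
        mutual_info b M U Y1 \<le> mutual_info b M U Y2)"

definition more_capable :: "real \<Rightarrow> real mat \<Rightarrow> real mat \<Rightarrow> bool" where
  "more_capable b K1 K2 \<longleftrightarrow> dim_row K1 = dim_row K2 \<and>
     (\<forall>(M :: nat measure) T Y1 Y2.
        prob_space M \<longrightarrow>
        generated_through M K1 T Y1 \<longrightarrow> generated_through M K2 T Y2 \<longrightarrow>
        mutual_info b M T Y1 \<le> mutual_info b M T Y2)"

definition degraded :: "real mat \<Rightarrow> real mat \<Rightarrow> bool" where
  "degraded K1 K2 \<longleftrightarrow>
     (\<exists>KU. row_stochastic KU \<and> dim_row KU = dim_col K2 \<and> K1 = K2 * KU)"

definition join_meet :: "nat \<Rightarrow> nat \<Rightarrow> real mat \<Rightarrow> real mat" where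
  "join_meet i j K = Matrix.mat (dim_row K) (dim_col K) (\<lambda>(t, l).
     if l = i then max (K $$ (t, i)) (K $$ (t, j))
     else if l = j then min (K $$ (t, i)) (K $$ (t, j))
     else K $$ (t, l))"

definition supermodular_le :: "real mat \<Rightarrow> real mat \<Rightarrow> bool" where
  "supermodular_le W V \<longleftrightarrow>
     (\<exists>ps. (\<forall>(i, j)\<in>set ps. i < dim_col V \<and> j < dim_col V \<and> i \<noteq> j) \<and>
           W = foldr (\<lambda>(i, j). join_meet i j) ps V)"

definition degradation_supermodular :: "real mat \<Rightarrow> real mat \<Rightarrow> bool" where
  "degradation_supermodular W V \<longleftrightarrow>
     (\<exists>Us. (\<forall>U\<in>set Us. row_stochastic U \<and> dim_row U = dim_row V) \<and>
           successively (\<lambda>K1 K2. degraded K1 K2 \<or> supermodular_le K1 K2) (W # Us @ [V]))"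

end

theory Submission
  imports Defs
begin

text \<open>
  A constant and \<open>Y\<^sub>i\<close> itself are functions of \<open>Y\<^sub>i\<close>, and \<open>Y\<^sub>i\<close> is a function of the tuple, so the
  channel on the left is always a degradation of the one on the right. By the data processing
  inequality degradation implies the less noisy preorder, and taking \<open>U = T\<close> the less noisy preorder
  implies the more capable one; this gives the second and the third axiom. For the first axiom,
  \<open>I(Y;T)\<close> depends only on the law of \<open>T\<close> and on the induced channel, so it suffices that, for a
  fixed input law, degradation and join--meet steps do not increase the mutual information.
\<close>

section \<open>Mutual information of a joint law\<close>

text \<open>The divergence of a joint law from the product of its marginals, taken on a bare
  nonnegative matrix so that laws from different sample spaces can be compared. A cell of mass zero
  contributes zero, whatever value the logarithm has there.\<close>

definition law_mi :: "real \<Rightarrow> 'x set \<Rightarrow> 'y set \<Rightarrow> ('x \<Rightarrow> 'y \<Rightarrow> real) \<Rightarrow> real" where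
  "law_mi b A B P = (\<Sum>x\<in>A. \<Sum>y\<in>B.
     P x y * log b (P x y / ((\<Sum>y'\<in>B. P x y') * (\<Sum>x'\<in>A. P x' y))))"

lemma law_mi_cong:
  assumes "A = A'" "B = B'" "\<And>x y. x \<in> A' \<Longrightarrow> y \<in> B' \<Longrightarrow> P x y = Q x y"
  shows "law_mi b A B P = law_mi b A' B' Q"
  unfolding law_mi_def using assms by simp

lemma law_mi_reindex:
  assumes f: "bij_betw f A' A" and g: "bij_betw g B' B"
  shows "law_mi b A' B' (\<lambda>x y. P (f x) (g y)) = law_mi b A B P"
proof -
  have "(\<Sum>x\<in>A'. P (f x) y) = (\<Sum>x\<in>A. P x y)" for y
    using sum.reindex_bij_betw[OF f, of "\<lambda>x. P x y"] .
  moreover have "(\<Sum>y\<in>B'. P x (g y)) = (\<Sum>y\<in>B. P x y)" for x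
    using sum.reindex_bij_betw[OF g, of "P x"] .
  ultimately show ?thesis
    unfolding law_mi_def
    using sum.reindex_bij_betw[OF f, of "\<lambda>x. \<Sum>y\<in>B. P x y * log b (P x y / (sum (P x) B * (\<Sum>x'\<in>A. P x' y)))"]
      sum.reindex_bij_betw[OF g, of "\<lambda>y. P (f x) y * log b (P (f x) y / (sum (P (f x)) B * (\<Sum>x'\<in>A. P x' y)))" for x]
    by simp
qed

lemma law_mi_swap: "law_mi b B A (\<lambda>y x. P x y) = law_mi b A B P"
  unfolding law_mi_def by (subst sum.swap) (simp add: mult.commute)

text \<open>Each summand on the right is bounded below by the tangent of the logarithm at the common
  ratio \<open>s = sum a I / sum c I\<close>, using \<open>ln x\<close> at most
  \<open>x - 1\<close>. The last assumption excludes quotients by zero with a positive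
  weight.\<close>

lemma log_sum_inequality:
  fixes a c :: "'i \<Rightarrow> real"
  assumes "finite I" "1 < b"
    and a: "\<And>i. i \<in> I \<Longrightarrow> 0 \<le> a i" and c: "\<And>i. i \<in> I \<Longrightarrow> 0 \<le> c i"
    and ac: "\<And>i. i \<in> I \<Longrightarrow> 0 < a i \<Longrightarrow> 0 < c i"
  shows "sum a I * log b (sum a I / sum c I) \<le> (\<Sum>i\<in>I. a i * log b (a i / c i))"
proof (cases "\<exists>i\<in>I. 0 < a i")
  case False
  then have "a i = 0" if "i \<in> I" for i using a[OF that] that by force
  then show ?thesis by simp
next
  case True
  then obtain j where j: "j \<in> I" "0 < a j" by blast
  define s where "s = sum a I / sum c I"
  have "0 < sum a I" using j a \<open>finite I\<close> by (meson sum_pos2)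
  moreover have c_pos: "0 < sum c I" using j ac c \<open>finite I\<close> by (meson sum_pos2)
  ultimately have s: "0 < s" by (simp add: s_def)
  have tangent: "a i * ln s + (a i - s * c i) \<le> a i * ln (a i / c i)" if i: "i \<in> I" for i
  proof (cases "0 < a i")
    case False
    then have "a i = 0" using a[OF i] by simp
    then show ?thesis using s c[OF i] by simp
  next
    case True
    then have pos: "0 < c i" using ac i by blast
    have "ln (s * c i / a i) \<le> s * c i / a i - 1"
      using True pos s by (intro ln_le_minus_one) simp
    then have "a i * ln (s * c i / a i) \<le> a i * (s * c i / a i - 1)"
      using True by (intro mult_left_mono) auto
    moreover have "ln (s * c i / a i) = ln s - ln (a i / c i)"
      using True pos s by (simp add: ln_div ln_mult)
    ultimately show ?thesis using True by (simp add: algebra_simps)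
  qed
  \<comment> \<open>By the choice of \<open>s\<close> the linear corrections
    \<open>a i - s * c i\<close> add up to zero, so summing the tangent bounds leaves the left-hand
    side.\<close>
  have "s * sum c I = sum a I" using c_pos by (simp add: s_def)
  then have "sum a I * ln s = (\<Sum>i\<in>I. a i * ln s + (a i - s * c i))"
    by (simp add: sum.distrib sum_subtractf flip: sum_distrib_left sum_distrib_right)
  also have "\<dots> \<le> (\<Sum>i\<in>I. a i * ln (a i / c i))"
    by (intro sum_mono tangent)
  finally have "sum a I * ln s / ln b \<le> (\<Sum>i\<in>I. a i * ln (a i / c i)) / ln b"
    using \<open>1 < b\<close> by (intro divide_right_mono) auto
  then show ?thesis by (simp add: log_def s_def sum_divide_distrib)
qed

text \<open>The log-sum inequality is applied over \<open>y\<close> for each fixed pair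
  \<open>(x, z)\<close>, comparing \<open>P x y * W y z\<close> with the product of marginals times
  \<open>W y z\<close>. The factor \<open>W y z\<close> cancels in the quotient, and summing over
  \<open>z\<close> removes it from the weights.\<close>

lemma data_processing:
  fixes P :: "'x \<Rightarrow> 'y \<Rightarrow> real" and W :: "'y \<Rightarrow> 'z \<Rightarrow> real"
  assumes fin: "finite A" "finite B" "finite C" and b: "1 < b"
    and P: "\<And>x y. x \<in> A \<Longrightarrow> y \<in> B \<Longrightarrow> 0 \<le> P x y"
    and W: "\<And>y z. y \<in> B \<Longrightarrow> z \<in> C \<Longrightarrow> 0 \<le> W y z"
    and W1: "\<And>y. y \<in> B \<Longrightarrow> (\<Sum>z\<in>C. W y z) = 1"
  shows "law_mi b A C (\<lambda>x z. \<Sum>y\<in>B. P x y * W y z) \<le> law_mi b A B P"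
proof -
  define R where "R x = (\<Sum>y\<in>B. P x y)" for x
  define Q where "Q y = (\<Sum>x\<in>A. P x y)" for y
  \<comment> \<open>Processing the output keeps the marginal \<open>R\<close> of the input and
    pushes the output marginal \<open>Q\<close> through \<open>W\<close>.\<close>
  have R': "(\<Sum>z\<in>C. \<Sum>y\<in>B. P x y * W y z) = R x" for x
    by (subst sum.swap) (simp add: sum_distrib_left[symmetric] W1 R_def)
  have Q': "(\<Sum>x\<in>A. \<Sum>y\<in>B. P x y * W y z) = (\<Sum>y\<in>B. Q y * W y z)" for z
    by (subst sum.swap) (simp add: sum_distrib_right[symmetric] Q_def)
  have step: "(\<Sum>y\<in>B. P x y * W y z) * log b ((\<Sum>y\<in>B. P x y * W y z) / (R x * (\<Sum>y\<in>B. Q y * W y z)))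
      \<le> (\<Sum>y\<in>B. P x y * W y z * log b (P x y / (R x * Q y)))"
    if xz: "x \<in> A" "z \<in> C" for x z
  proof -
    have R0: "0 \<le> R x" unfolding R_def by (intro sum_nonneg P xz)
    have Q0: "0 \<le> Q y" if "y \<in> B" for y unfolding Q_def by (intro sum_nonneg P that)
    have "(\<Sum>y\<in>B. P x y * W y z) * log b ((\<Sum>y\<in>B. P x y * W y z) / (\<Sum>y\<in>B. R x * (Q y * W y z)))
      \<le> (\<Sum>y\<in>B. P x y * W y z * log b (P x y * W y z / (R x * (Q y * W y z))))"
    proof (rule log_sum_inequality[OF fin(2) b])
      fix y assume y: "y \<in> B"
      show "0 \<le> P x y * W y z" "0 \<le> R x * (Q y * W y z)"
        using P W R0 Q0 xz y by auto
      assume "0 < P x y * W y z"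
      then have "0 < P x y" "0 < W y z"
        using P[OF xz(1) y] W[OF y xz(2)] by (auto simp: zero_less_mult_iff)
      moreover from this have "0 < R x" "0 < Q y"
        unfolding R_def Q_def using P xz y fin by (auto intro: sum_pos2)
      ultimately show "0 < R x * (Q y * W y z)" by simp
    qed
    also have "(\<Sum>y\<in>B. R x * (Q y * W y z)) = R x * (\<Sum>y\<in>B. Q y * W y z)"
      by (simp add: sum_distrib_left)
    also have "(\<Sum>y\<in>B. P x y * W y z * log b (P x y * W y z / (R x * (Q y * W y z))))
        = (\<Sum>y\<in>B. P x y * W y z * log b (P x y / (R x * Q y)))"
    proof (rule sum.cong[OF refl])
      fix y
      \<comment> \<open>Cancellation requires \<open>W y z\<close> to be nonzero; if it is zero, the
        prefactor makes both sides zero.\<close>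
      show "P x y * W y z * log b (P x y * W y z / (R x * (Q y * W y z)))
          = P x y * W y z * log b (P x y / (R x * Q y))"
        by (cases "W y z = 0") (simp_all add: mult.assoc[symmetric])
    qed
    finally show ?thesis .
  qed
  have "law_mi b A C (\<lambda>x z. \<Sum>y\<in>B. P x y * W y z)
      \<le> (\<Sum>x\<in>A. \<Sum>z\<in>C. \<Sum>y\<in>B. P x y * W y z * log b (P x y / (R x * Q y)))"
    unfolding law_mi_def R' Q' by (intro sum_mono step)
  also have "\<dots> = (\<Sum>x\<in>A. \<Sum>y\<in>B. \<Sum>z\<in>C. W y z * (P x y * log b (P x y / (R x * Q y))))"
    by (intro sum.cong refl, subst sum.swap) (simp add: mult_ac)
  also have "\<dots> = law_mi b A B P"
    by (simp add: sum_distrib_right[symmetric] W1 law_mi_def R_def Q_def)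
  finally show ?thesis .
qed

text \<open>A cell of positive mass has positive marginals, so the logarithm of the quotient splits
  there. This is \<open>I(X;Y) = H(X) + H(Y) - H(X,Y)\<close> with unnormalised entropies, which
  lets a change of one marginal be studied alone.\<close>

lemma law_mi_eq_entropies:
  fixes P :: "'x \<Rightarrow> 'y \<Rightarrow> real"
  assumes fin: "finite A" "finite B"
    and P: "\<And>x y. x \<in> A \<Longrightarrow> y \<in> B \<Longrightarrow> 0 \<le> P x y"
  shows "law_mi b A B P = ((\<Sum>x\<in>A. \<Sum>y\<in>B. P x y * ln (P x y))
    - (\<Sum>x\<in>A. (\<Sum>y\<in>B. P x y) * ln (\<Sum>y\<in>B. P x y))
    - (\<Sum>y\<in>B. (\<Sum>x\<in>A. P x y) * ln (\<Sum>x\<in>A. P x y))) / ln b"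
proof -
  have "P x y * log b (P x y / ((\<Sum>y'\<in>B. P x y') * (\<Sum>x'\<in>A. P x' y)))
      = (P x y * ln (P x y) - P x y * ln (\<Sum>y'\<in>B. P x y') - P x y * ln (\<Sum>x'\<in>A. P x' y)) / ln b"
    if xy: "x \<in> A" "y \<in> B" for x y
  proof (cases "P x y = 0")
    case False
    then have pos: "0 < P x y" using P[OF xy] by simp
    then have "0 < (\<Sum>y'\<in>B. P x y')" "0 < (\<Sum>x'\<in>A. P x' y)"
      using P xy fin by (auto intro: sum_pos2)
    with pos show ?thesis by (simp add: log_def ln_div ln_mult algebra_simps)
  qed simp
  then have "law_mi b A B P = (\<Sum>x\<in>A. \<Sum>y\<in>B.
      (P x y * ln (P x y) - P x y * ln (\<Sum>y'\<in>B. P x y') - P x y * ln (\<Sum>x'\<in>A. P x' y)) / ln b)"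
    unfolding law_mi_def by (intro sum.cong) auto
  also have "\<dots> = ((\<Sum>x\<in>A. \<Sum>y\<in>B. P x y * ln (P x y))
    - (\<Sum>x\<in>A. \<Sum>y\<in>B. P x y * ln (\<Sum>y'\<in>B. P x y'))
    - (\<Sum>x\<in>A. \<Sum>y\<in>B. P x y * ln (\<Sum>x'\<in>A. P x' y))) / ln b"
    by (simp add: sum_divide_distrib[symmetric] sum_subtractf)
  also have "(\<Sum>x\<in>A. \<Sum>y\<in>B. P x y * ln (\<Sum>x'\<in>A. P x' y))
      = (\<Sum>y\<in>B. (\<Sum>x\<in>A. P x y) * ln (\<Sum>x\<in>A. P x y))"
    by (subst sum.swap) (simp add: sum_distrib_right)
  finally show ?thesis by (simp add: sum_distrib_right)
qed

text \<open>Convexity of \<open>x * ln x\<close>: the pair \<open>(u, v)\<close> has the same sum as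
  \<open>(x, y)\<close> and is more spread out. The graph lies above its tangent at the larger of
  \<open>x\<close> and \<open>y\<close>, used for \<open>u\<close>, and above its tangent at the
  smaller, used for \<open>v\<close>.\<close>

lemma xlnx_spread:
  fixes x y u v :: real
  assumes "u + v = x + y" "x \<le> u" "y \<le> u" "0 \<le> v" "0 \<le> x" "0 \<le> y"
  shows "x * ln x + y * ln y \<le> u * ln u + v * ln v"
proof (cases "x = 0 \<or> y = 0")
  case True
  \<comment> \<open>At zero the tangent has no finite slope, but then \<open>(u, v)\<close> is
    merely a rearrangement of \<open>(x, y)\<close>.\<close>
  then have "x = u \<and> y = v \<or> x = v \<and> y = u" using assms by auto
  then show ?thesis by auto
next
  case False
  then have pos: "0 < x" "0 < y" "0 < u" using assms by auto
  have tangent: "z * ln z + (1 + ln z) * (w - z) \<le> w * ln w" if "0 < z" "0 \<le> w" for z w :: real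
  proof (cases "w = 0")
    case False
    then have "w * ln (z / w) \<le> w * (z / w - 1)"
      using that by (intro mult_left_mono ln_le_minus_one) auto
    then show ?thesis using that False by (simp add: ln_div algebra_simps)
  qed (use that in \<open>simp add: algebra_simps\<close>)
  show ?thesis
  proof (cases "y \<le> x")
    case True
    \<comment> \<open>The displacements \<open>u - x\<close> and \<open>v - y\<close> are opposite,
      so adding the two tangent bounds leaves the difference of the slopes times
      \<open>u - x\<close>.\<close>
    have "0 \<le> (ln x - ln y) * (u - x)" using True pos assms by (intro mult_nonneg_nonneg) auto
    moreover have "v - y = x - u" using assms by simp
    then have "y * ln y + (1 + ln y) * (x - u) \<le> v * ln v"
      using tangent[of y v] pos assms(4) by simp
    ultimately show ?thesis using tangent[of x u] pos by (simp add: algebra_simps)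
  next
    case False
    have "0 \<le> (ln y - ln x) * (u - y)" using False pos assms by (intro mult_nonneg_nonneg) auto
    moreover have "v - x = y - u" using assms by simp
    then have "x * ln x + (1 + ln x) * (y - u) \<le> v * ln v"
      using tangent[of x v] pos assms(4) by simp
    ultimately show ?thesis using tangent[of y u] pos by (simp add: algebra_simps)
  qed
qed

lemma sum_two_points:
  fixes f :: "'y \<Rightarrow> real"
  assumes "finite B" "i \<in> B" "j \<in> B" "i \<noteq> j"
  shows "sum f B = f i + f j + sum f (B - {i, j})"
  using assms sum.subset_diff[of "{i, j}" B f] by simp

text \<open>
  The join--meet operation permutes each row within the columns \<open>i\<close> and \<open>j\<close>, so it changes only
  the marginal of the output, whose entropy it lowers by spreading the masses of \<open>i\<close> and \<open>j\<close>.
\<close>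

lemma law_mi_join_meet:
  fixes P :: "'x \<Rightarrow> 'y \<Rightarrow> real"
  assumes fin: "finite A" "finite B" and b: "1 < b"
    and P: "\<And>x y. x \<in> A \<Longrightarrow> y \<in> B \<Longrightarrow> 0 \<le> P x y"
    and ij: "i \<in> B" "j \<in> B" "i \<noteq> j"
  shows "law_mi b A B (\<lambda>x y. if y = i then max (P x i) (P x j)
      else if y = j then min (P x i) (P x j) else P x y) \<le> law_mi b A B P"
proof -
  define Q where "Q x y = (if y = i then max (P x i) (P x j)
      else if y = j then min (P x i) (P x j) else P x y)" for x y
  note split = sum_two_points[OF fin(2) ij]
  have Q0: "0 \<le> Q x y" if "x \<in> A" "y \<in> B" for x y
    using P[OF that(1)] that ij by (auto simp: Q_def max_def)
  \<comment> \<open>Keeping \<open>f\<close> general serves twice: \<open>z * ln z\<close> gives the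
    joint entropy term and the identity gives the row sums.\<close>
  have row: "(\<Sum>y\<in>B. f (Q x y)) = (\<Sum>y\<in>B. f (P x y))" for x and f :: "real \<Rightarrow> real"
  proof -
    have "(\<Sum>y\<in>B - {i, j}. f (Q x y)) = (\<Sum>y\<in>B - {i, j}. f (P x y))"
      by (intro sum.cong) (auto simp: Q_def)
    then show ?thesis using ij by (simp add: split Q_def max_def min_def)
  qed
  have col: "(\<Sum>y\<in>B. (\<Sum>x\<in>A. P x y) * ln (\<Sum>x\<in>A. P x y))
      \<le> (\<Sum>y\<in>B. (\<Sum>x\<in>A. Q x y) * ln (\<Sum>x\<in>A. Q x y))"
  proof -
    have "(\<Sum>y\<in>B - {i, j}. (\<Sum>x\<in>A. P x y) * ln (\<Sum>x\<in>A. P x y))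
        = (\<Sum>y\<in>B - {i, j}. (\<Sum>x\<in>A. Q x y) * ln (\<Sum>x\<in>A. Q x y))"
      by (intro sum.cong) (auto simp: Q_def)
    moreover have "(\<Sum>x\<in>A. P x i) * ln (\<Sum>x\<in>A. P x i) + (\<Sum>x\<in>A. P x j) * ln (\<Sum>x\<in>A. P x j)
      \<le> (\<Sum>x\<in>A. Q x i) * ln (\<Sum>x\<in>A. Q x i) + (\<Sum>x\<in>A. Q x j) * ln (\<Sum>x\<in>A. Q x j)"
    \<comment> \<open>The column of maxima dominates both old columns entry by entry, so its sum
      plays the role of \<open>u\<close>.\<close>
    proof (rule xlnx_spread)
      show "(\<Sum>x\<in>A. Q x i) + (\<Sum>x\<in>A. Q x j) = (\<Sum>x\<in>A. P x i) + (\<Sum>x\<in>A. P x j)"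
        unfolding sum.distrib[symmetric] using ij by (intro sum.cong) (auto simp: Q_def)
      show "(\<Sum>x\<in>A. P x i) \<le> (\<Sum>x\<in>A. Q x i)" "(\<Sum>x\<in>A. P x j) \<le> (\<Sum>x\<in>A. Q x i)"
        by (intro sum_mono, simp add: Q_def)+
    qed (use P Q0 ij in \<open>auto intro!: sum_nonneg\<close>)
    ultimately show ?thesis by (simp add: split)
  qed
  have "law_mi b A B Q \<le> law_mi b A B P"
    using row[where f="\<lambda>z. z * ln z"] row[where f="\<lambda>z. z"] col b P Q0
    by (subst (1 2) law_mi_eq_entropies[OF fin]) (auto intro!: divide_right_mono)
  then show ?thesis by (simp only: Q_def[abs_def])
qed

section \<open>Mutual information through a channel\<close>

text \<open>The input law is a separate argument, so that channels with different outputs are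
  compared under the same weights.\<close>

definition channel_mi :: "real \<Rightarrow> (nat \<Rightarrow> real) \<Rightarrow> real mat \<Rightarrow> real" where
  "channel_mi b p K = law_mi b {..<dim_row K} {..<dim_col K} (\<lambda>t y. p t * K $$ (t, y))"

text \<open>The invariant carried along chains of channels: join-meet steps preserve it, and
  row-stochastic matrices and induced channels have it.\<close>

definition nonneg_mat :: "real mat \<Rightarrow> bool" where
  "nonneg_mat K \<longleftrightarrow> (\<forall>i<dim_row K. \<forall>j<dim_col K. 0 \<le> K $$ (i, j))"

lemma times_mat_index_sum:
  assumes "i < dim_row A" "j < dim_col B" "dim_col A = dim_row B"
  shows "(A * B :: real mat) $$ (i, j) = (\<Sum>k<dim_col A. A $$ (i, k) * B $$ (k, j))"
  using assms by (simp add: scalar_prod_def lessThan_atLeast0)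

text \<open>Weighting the rows by \<open>p\<close> commutes with multiplying by \<open>KU\<close> on
  the right, so the degraded joint law is a processed one.\<close>

lemma channel_mi_degraded:
  assumes b: "1 < b" and p: "\<And>t. t < dim_row V \<Longrightarrow> 0 \<le> p t" and V: "nonneg_mat V"
    and "degraded W V"
  shows "channel_mi b p W \<le> channel_mi b p V"
proof -
  obtain KU where KU: "row_stochastic KU" "dim_row KU = dim_col V" "W = V * KU"
    using \<open>degraded W V\<close> by (auto simp: degraded_def)
  have "channel_mi b p W = law_mi b {..<dim_row V} {..<dim_col KU}
      (\<lambda>t z. \<Sum>y<dim_col V. p t * V $$ (t, y) * KU $$ (y, z))"
    unfolding channel_mi_def using KU
    by (intro law_mi_cong) (auto simp: times_mat_index_sum sum_distrib_left mult.assoc simp del: index_mult_mat(1))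
  also have "\<dots> \<le> channel_mi b p V"
    unfolding channel_mi_def using p V KU b
    by (intro data_processing) (auto simp: row_stochastic_def nonneg_mat_def)
  finally show ?thesis .
qed

lemma dim_join_meet [simp]:
  "dim_row (join_meet i j K) = dim_row K" "dim_col (join_meet i j K) = dim_col K"
  by (auto simp: join_meet_def)

lemma nonneg_join_meet:
  assumes "nonneg_mat K" "i < dim_col K" "j < dim_col K"
  shows "nonneg_mat (join_meet i j K)"
  using assms by (auto simp: nonneg_mat_def join_meet_def max_def)

text \<open>A nonnegative factor \<open>p t\<close> passes through maximum and minimum, so the
  operation on the channel is the same operation on the joint law.\<close>

lemma channel_mi_join_meet:
  assumes b: "1 < b" and p: "\<And>t. t < dim_row K \<Longrightarrow> 0 \<le> p t" and K: "nonneg_mat K"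
    and ij: "i < dim_col K" "j < dim_col K" "i \<noteq> j"
  shows "channel_mi b p (join_meet i j K) \<le> channel_mi b p K"
proof -
  let ?P = "\<lambda>t y. p t * K $$ (t, y)"
  have "channel_mi b p (join_meet i j K) = law_mi b {..<dim_row K} {..<dim_col K}
      (\<lambda>t y. if y = i then max (?P t i) (?P t j)
        else if y = j then min (?P t i) (?P t j) else ?P t y)"
    unfolding channel_mi_def using p
    by (intro law_mi_cong) (auto simp: join_meet_def max_mult_distrib_left min_mult_distrib_left)
  also have "\<dots> \<le> channel_mi b p K"
    unfolding channel_mi_def using p K ij b
    by (intro law_mi_join_meet) (auto simp: nonneg_mat_def)
  finally show ?thesis .
qed

lemma channel_mi_supermodular:
  assumes b: "1 < b" and p: "\<And>t. t < dim_row V \<Longrightarrow> 0 \<le> p t" and V: "nonneg_mat V"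
    and "supermodular_le W V"
  shows "channel_mi b p W \<le> channel_mi b p V"
proof -
  obtain ps where ps: "\<forall>(i, j)\<in>set ps. i < dim_col V \<and> j < dim_col V \<and> i \<noteq> j"
    and W: "W = foldr (\<lambda>(i, j). join_meet i j) ps V"
    using \<open>supermodular_le W V\<close> by (auto simp: supermodular_le_def)
  \<comment> \<open>\<open>foldr\<close> applies the last tuple first, so the values of
    \<open>J\<close> on the suffixes of \<open>ps\<close> are exactly the intermediate
    matrices.\<close>
  define J where "J qs = foldr (\<lambda>(i, j). join_meet i j) qs V" for qs
  have J_simps: "J [] = V" "\<And>i j qs. J ((i, j) # qs) = join_meet i j (J qs)"
    by (simp_all add: J_def)
  have dims: "dim_row (J qs) = dim_row V \<and> dim_col (J qs) = dim_col V" for qs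
    by (induction qs) (auto simp: J_simps)
  from ps have "nonneg_mat (J ps) \<and> channel_mi b p (J ps) \<le> channel_mi b p V"
  proof (induction ps)
    case Nil
    then show ?case using V by (simp add: J_simps)
  next
    case (Cons q qs)
    obtain i j where q: "q = (i, j)" by force
    have IH: "nonneg_mat (J qs)" "channel_mi b p (J qs) \<le> channel_mi b p V"
      using Cons by auto
    have ij: "i < dim_col (J qs)" "j < dim_col (J qs)" "i \<noteq> j"
      using Cons.prems q dims by auto
    have "channel_mi b p (join_meet i j (J qs)) \<le> channel_mi b p (J qs)"
      using b p IH(1) ij dims by (intro channel_mi_join_meet) auto
    with IH nonneg_join_meet[OF IH(1) ij(1,2)] show ?case by (simp add: q J_simps)
  qed
  then show ?thesis by (simp add: W J_def)
qed

text \<open>Both kinds of step ask for nonnegativity of their right-hand channel, which is either a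
  row-stochastic intermediate one or \<open>V\<close>. The induction generalises \<open>W\<close>
  because the head of the chain changes.\<close>

lemma channel_mi_degradation_supermodular:
  assumes b: "1 < b" and p: "\<And>t. t < dim_row V \<Longrightarrow> 0 \<le> p t" and V: "nonneg_mat V"
    and "degradation_supermodular W V"
  shows "channel_mi b p W \<le> channel_mi b p V"
proof -
  let ?le = "\<lambda>K1 K2. degraded K1 K2 \<or> supermodular_le K1 K2"
  have step: "channel_mi b p W' \<le> channel_mi b p V'"
    if "?le W' V'" "nonneg_mat V'" "dim_row V' = dim_row V" for W' V'
    using that b p channel_mi_degraded[of b V' p W'] channel_mi_supermodular[of b V' p W'] by auto
  obtain Us where "\<forall>U\<in>set Us. row_stochastic U \<and> dim_row U = dim_row V"
    and "successively ?le (W # Us @ [V])"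
    using \<open>degradation_supermodular W V\<close> by (auto simp: degradation_supermodular_def)
  then show ?thesis
  proof (induction Us arbitrary: W)
    case Nil
    then show ?case using step V by simp
  next
    case (Cons U Us)
    then have "channel_mi b p U \<le> channel_mi b p V" by simp
    moreover have "channel_mi b p W \<le> channel_mi b p U"
      using Cons.prems by (intro step) (auto simp: row_stochastic_def nonneg_mat_def)
    ultimately show ?case by simp
  qed
qed

section \<open>Finitely valued random variables\<close>

text \<open>With \<open>Q\<close> always true this is the law of total probability; with
  \<open>Q\<close> describing a fibre of a function of \<open>Y\<close> it computes the law of that
  function.\<close>

lemma prob_partition:
  assumes M: "prob_space M" and Y: "simple_function M Y" and B: "finite B" "AE \<omega> in M. Y \<omega> \<in> B"
    and A: "{\<omega>\<in>space M. A \<omega>} \<in> sets M"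
  shows "\<P>(\<omega> in M. A \<omega> \<and> Q (Y \<omega>)) = (\<Sum>y\<in>B. if Q y then \<P>(\<omega> in M. A \<omega> \<and> Y \<omega> = y) else 0)"
proof -
  interpret prob_space M by fact
  note Y[measurable] A[measurable]
  have [measurable]: "Measurable.pred M (\<lambda>\<omega>. Q (Y \<omega>))"
    by (rule measurable_compose[OF measurable_simple_function[OF Y]]) simp
  have "\<P>(\<omega> in M. A \<omega> \<and> Q (Y \<omega>)) = (\<Sum>y\<in>B. \<P>(\<omega> in M. A \<omega> \<and> Q y \<and> Y \<omega> = y))"
    by (rule prob_sum[OF B(1)]) (use B(2) in auto)
  also have "\<dots> = (\<Sum>y\<in>B. if Q y then \<P>(\<omega> in M. A \<omega> \<and> Y \<omega> = y) else 0)"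
    by (intro sum.cong) auto
  finally show ?thesis .
qed

lemma prob_total:
  assumes M: "prob_space M" and Y: "simple_function M Y" and B: "finite B" "AE \<omega> in M. Y \<omega> \<in> B"
    and A: "{\<omega>\<in>space M. A \<omega>} \<in> sets M"
  shows "(\<Sum>y\<in>B. \<P>(\<omega> in M. A \<omega> \<and> Y \<omega> = y)) = \<P>(\<omega> in M. A \<omega>)"
  using prob_partition[OF assms, of "\<lambda>_. True"] by simp

lemma events_eq:
  assumes "simple_function M X"
  shows "{\<omega>\<in>space M. X \<omega> = x} \<in> sets M"
  using assms by measurable

text \<open>The known formula sums over the attained pairs, whereas \<open>A\<close> and
  \<open>B\<close> may contain values never attained and omit attained ones of probability zero. The
  two index sets are compared through their union; all terms gained or lost have probability
  zero.\<close>

lemma mutual_info_eq_law_mi: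
  assumes M: "prob_space M" and b: "1 < b"
    and X: "simple_function M X" and Y: "simple_function M Y"
    and A: "finite A" "AE \<omega> in M. X \<omega> \<in> A" and B: "finite B" "AE \<omega> in M. Y \<omega> \<in> B"
  shows "mutual_info b M X Y = law_mi b A B (\<lambda>x y. \<P>(\<omega> in M. X \<omega> = x \<and> Y \<omega> = y))"
proof -
  interpret information_space M b
    using M b by (simp add: information_space_def information_space_axioms_def)
  note X[measurable] Y[measurable]
  let ?Px = "\<lambda>x. \<P>(\<omega> in M. X \<omega> = x)" and ?Py = "\<lambda>y. \<P>(\<omega> in M. Y \<omega> = y)"
  let ?P = "\<lambda>x y. \<P>(\<omega> in M. X \<omega> = x \<and> Y \<omega> = y)"
  let ?f = "\<lambda>(x, y). ?P x y * log b (?P x y / (?Px x * ?Py y))"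
  let ?S = "(\<lambda>\<omega>. (X \<omega>, Y \<omega>)) ` space M"
  have XY: "simple_function M (\<lambda>\<omega>. (X \<omega>, Y \<omega>))" by (rule simple_function_Pair[OF X Y])
  have "mutual_info b M X Y = (\<Sum>(x, y)\<in>?S. (\<lambda>(x, y). ?P x y) (x, y)
      * log b ((\<lambda>(x, y). ?P x y) (x, y) / (?Px x * ?Py y)))"
    by (rule mutual_information_simple_distributed;
        rule simple_distributedI) (use X Y XY in \<open>auto simp: vimage_def Int_def conj_commute intro!: arg_cong[where f=prob]\<close>)
  also have "\<dots> = sum ?f ?S" by simp
  also have "\<dots> = sum ?f (?S \<union> A \<times> B)"
  proof (rule sum.mono_neutral_left)
    show "finite (?S \<union> A \<times> B)" using simple_functionD(1)[OF XY] A B by simp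
    show "\<forall>z\<in>(?S \<union> A \<times> B) - ?S. ?f z = 0"
    proof
      fix z assume "z \<in> (?S \<union> A \<times> B) - ?S"
      then obtain x y where z: "z = (x, y)" "(x, y) \<notin> ?S" by (cases z) auto
      then have "{\<omega>\<in>space M. X \<omega> = x \<and> Y \<omega> = y} = {}" by auto
      then have "?P x y = 0" by (simp only: measure_empty)
      then show "?f z = 0" by (simp add: z)
    qed
  qed auto
  also have "\<dots> = sum ?f (A \<times> B)"
  proof (rule sum.mono_neutral_right)
    show "finite (?S \<union> A \<times> B)" using simple_functionD(1)[OF XY] A B by simp
    show "\<forall>z\<in>(?S \<union> A \<times> B) - A \<times> B. ?f z = 0"
    proof
      fix z assume "z \<in> (?S \<union> A \<times> B) - A \<times> B"
      then obtain x y where z: "z = (x, y)" "x \<notin> A \<or> y \<notin> B" by (cases z) auto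
      have "AE \<omega> in M. \<not> (X \<omega> = x \<and> Y \<omega> = y)"
        using A(2) B(2) by eventually_elim (use z in auto)
      then have "?P x y = 0" by (subst prob_eq_0) auto
      then show "?f z = 0" by (simp add: z)
    qed
  qed auto
  also have "\<dots> = law_mi b A B ?P"
    using prob_total[OF M Y B events_eq[OF X]] prob_total[OF M X A events_eq[OF Y]]
    by (simp add: law_mi_def sum.cartesian_product conj_commute)
  finally show ?thesis .
qed

text \<open>The conditional probability is multiplied out. For an input of probability zero, on
  which \<open>generated_through\<close> imposes no conditional law, both sides vanish.\<close>

lemma prob_generated_through:
  assumes M: "prob_space M" and "generated_through M K T Y" and ty: "t < dim_row K" "y < dim_col K"
  shows "\<P>(\<omega> in M. T \<omega> = t \<and> Y \<omega> = y) = \<P>(\<omega> in M. T \<omega> = t) * K $$ (t, y)"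
proof -
  interpret prob_space M by fact
  have T[measurable]: "simple_function M T" and Y[measurable]: "simple_function M Y"
    using assms(2) by (auto simp: generated_through_def)
  show ?thesis
  proof (cases "0 < \<P>(\<omega> in M. T \<omega> = t)")
    case True
    then have "cond_prob M (\<lambda>\<omega>. Y \<omega> = y) (\<lambda>\<omega>. T \<omega> = t) = K $$ (t, y)"
      using assms(2) ty by (simp add: generated_through_def)
    with True show ?thesis by (simp add: cond_prob_def conj_commute field_simps)
  next
    case False
    then have "\<P>(\<omega> in M. T \<omega> = t) = 0" by (simp add: zero_less_measure_iff)
    moreover have "\<P>(\<omega> in M. T \<omega> = t \<and> Y \<omega> = y) \<le> \<P>(\<omega> in M. T \<omega> = t)"
      by (intro finite_measure_mono) auto
    ultimately show ?thesis by (simp add: measure_le_0_iff)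
  qed
qed

lemma mutual_info_generated_through:
  assumes M: "prob_space M" and b: "1 < b" and g: "generated_through M K T Y"
  shows "mutual_info b M T Y = channel_mi b (\<lambda>t. \<P>(\<omega> in M. T \<omega> = t)) K"
proof -
  have "mutual_info b M T Y = law_mi b {..<dim_row K} {..<dim_col K}
      (\<lambda>t y. \<P>(\<omega> in M. T \<omega> = t \<and> Y \<omega> = y))"
    using g by (intro mutual_info_eq_law_mi[OF M b]) (auto simp: generated_through_def intro!: AE_I2)
  also have "\<dots> = channel_mi b (\<lambda>t. \<P>(\<omega> in M. T \<omega> = t)) K"
    unfolding channel_mi_def by (intro law_mi_cong) (auto simp: prob_generated_through[OF M g])
  finally show ?thesis .
qed

text \<open>The event is split by the value \<open>t\<close> of \<open>T\<close>; given
  \<open>t\<close>, the Markov property separates \<open>U\<close> from \<open>Y\<close>, and the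
  channel supplies the second factor. Inputs of probability zero contribute nothing on either
  side.\<close>

lemma prob_markov_chain:
  assumes M: "prob_space M" and g: "generated_through M K T Y" and U: "simple_function M U"
    and mc: "markov_chain M U T Y" and y: "y < dim_col K"
  shows "\<P>(\<omega> in M. U \<omega> = u \<and> Y \<omega> = y) = (\<Sum>t<dim_row K. \<P>(\<omega> in M. U \<omega> = u \<and> T \<omega> = t) * K $$ (t, y))"
proof -
  interpret prob_space M by fact
  have T[measurable]: "simple_function M T" and Y[measurable]: "simple_function M Y"
    and Tr: "AE \<omega> in M. T \<omega> \<in> {..<dim_row K}"
    using g by (auto simp: generated_through_def intro!: AE_I2)
  note U[measurable]
  have "\<P>(\<omega> in M. (U \<omega> = u \<and> Y \<omega> = y) \<and> T \<omega> = t) = \<P>(\<omega> in M. U \<omega> = u \<and> T \<omega> = t) * K $$ (t, y)"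
    if t: "t < dim_row K" for t
  proof (cases "0 < \<P>(\<omega> in M. T \<omega> = t)")
    case True
    then have "cond_prob M (\<lambda>\<omega>. U \<omega> = u \<and> Y \<omega> = y) (\<lambda>\<omega>. T \<omega> = t)
        = cond_prob M (\<lambda>\<omega>. U \<omega> = u) (\<lambda>\<omega>. T \<omega> = t) * K $$ (t, y)"
      using mc g t y by (simp add: markov_chain_def generated_through_def)
    with True show ?thesis by (simp add: cond_prob_def)
  next
    case False
    then have 0: "\<P>(\<omega> in M. T \<omega> = t) = 0" by (simp add: zero_less_measure_iff)
    have "\<P>(\<omega> in M. (U \<omega> = u \<and> Y \<omega> = y) \<and> T \<omega> = t) \<le> \<P>(\<omega> in M. T \<omega> = t)"
      "\<P>(\<omega> in M. U \<omega> = u \<and> T \<omega> = t) \<le> \<P>(\<omega> in M. T \<omega> = t)"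
      by (intro finite_measure_mono; auto)+
    with 0 show ?thesis by (simp add: measure_le_0_iff)
  qed
  moreover have "\<P>(\<omega> in M. U \<omega> = u \<and> Y \<omega> = y) = (\<Sum>t<dim_row K. \<P>(\<omega> in M. (U \<omega> = u \<and> Y \<omega> = y) \<and> T \<omega> = t))"
    by (rule prob_total[OF M T _ Tr, symmetric]) auto
  ultimately show ?thesis by simp
qed

lemma mutual_info_markov_chain:
  assumes M: "prob_space M" and b: "1 < b" and g: "generated_through M K T Y"
    and U: "simple_function M U" and mc: "markov_chain M U T Y"
  shows "mutual_info b M U Y = law_mi b (U ` space M) {..<dim_col K}
    (\<lambda>u y. \<Sum>t<dim_row K. \<P>(\<omega> in M. U \<omega> = u \<and> T \<omega> = t) * K $$ (t, y))"
proof -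
  have "mutual_info b M U Y = law_mi b (U ` space M) {..<dim_col K}
      (\<lambda>u y. \<P>(\<omega> in M. U \<omega> = u \<and> Y \<omega> = y))"
    using g U by (intro mutual_info_eq_law_mi[OF M b])
      (auto simp: generated_through_def intro!: AE_I2 dest: simple_functionD(1))
  also have "\<dots> = law_mi b (U ` space M) {..<dim_col K}
    (\<lambda>u y. \<Sum>t<dim_row K. \<P>(\<omega> in M. U \<omega> = u \<and> T \<omega> = t) * K $$ (t, y))"
    by (intro law_mi_cong) (auto simp: prob_markov_chain[OF M g U mc])
  finally show ?thesis .
qed

section \<open>Relations between the preorders\<close>

text \<open>By associativity of matrix multiplication, the joint law of \<open>U\<close> and
  \<open>Y1\<close> is that of \<open>U\<close> and \<open>Y2\<close> times \<open>KU\<close>, so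
  data processing applies. Only these two pair laws enter; the coupling of \<open>Y1\<close> with
  \<open>Y2\<close> is arbitrary.\<close>

lemma less_noisy_if_degraded:
  assumes b: "1 < b" and V: "nonneg_mat V" and "degraded W V"
  shows "less_noisy b W V"
proof -
  obtain KU where KU: "row_stochastic KU" "dim_row KU = dim_col V" "W = V * KU"
    using \<open>degraded W V\<close> by (auto simp: degraded_def)
  have "mutual_info b M U Y1 \<le> mutual_info b M U Y2"
    if M: "prob_space M" and U: "simple_function M U"
      and g1: "generated_through M W T Y1" and g2: "generated_through M V T Y2"
      and m1: "markov_chain M U T Y1" and m2: "markov_chain M U T Y2"
    for M :: "nat measure" and U :: "nat \<Rightarrow> nat" and T Y1 Y2
  proof -
    let ?J = "\<lambda>u t. \<P>(\<omega> in M. U \<omega> = u \<and> T \<omega> = t)"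
    have W: "(\<Sum>t<dim_row V. ?J u t * (V * KU) $$ (t, z))
        = (\<Sum>y<dim_col V. (\<Sum>t<dim_row V. ?J u t * V $$ (t, y)) * KU $$ (y, z))"
      if z: "z < dim_col KU" for u z
    proof -
      have "(\<Sum>t<dim_row V. ?J u t * (V * KU) $$ (t, z))
          = (\<Sum>t<dim_row V. \<Sum>y<dim_col V. ?J u t * V $$ (t, y) * KU $$ (y, z))"
        using KU(2) z by (intro sum.cong refl)
          (simp add: times_mat_index_sum sum_distrib_left mult.assoc del: index_mult_mat(1))
      then show ?thesis by (subst (asm) sum.swap) (simp add: sum_distrib_right)
    qed
    have "mutual_info b M U Y1 = law_mi b (U ` space M) {..<dim_col KU}
      (\<lambda>u z. \<Sum>y<dim_col V. (\<Sum>t<dim_row V. ?J u t * V $$ (t, y)) * KU $$ (y, z))"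
      unfolding mutual_info_markov_chain[OF M b g1 U m1]
      by (intro law_mi_cong) (use KU(3) W in auto)
    also have "\<dots> \<le> law_mi b (U ` space M) {..<dim_col V}
      (\<lambda>u y. \<Sum>t<dim_row V. ?J u t * V $$ (t, y))"
      using KU V b simple_functionD(1)[OF U]
      by (intro data_processing) (auto simp: row_stochastic_def nonneg_mat_def intro!: sum_nonneg)
    also have "\<dots> = mutual_info b M U Y2"
      unfolding mutual_info_markov_chain[OF M b g2 U m2] ..
    finally show ?thesis .
  qed
  then show ?thesis unfolding less_noisy_def using KU(3) by auto
qed

text \<open>Given the value of \<open>T\<close>, an event about \<open>T\<close> is certain or
  impossible, hence independent of \<open>Y\<close>.\<close>

lemma markov_chain_self: "markov_chain M T T Y"
  unfolding markov_chain_def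
proof (intro allI impI)
  fix x y z assume pos: "0 < \<P>(\<omega> in M. T \<omega> = y)"
  show "cond_prob M (\<lambda>\<omega>. T \<omega> = x \<and> Y \<omega> = z) (\<lambda>\<omega>. T \<omega> = y)
      = cond_prob M (\<lambda>\<omega>. T \<omega> = x) (\<lambda>\<omega>. T \<omega> = y) * cond_prob M (\<lambda>\<omega>. Y \<omega> = z) (\<lambda>\<omega>. T \<omega> = y)"
  proof (cases "x = y")
    case True
    then show ?thesis using pos
      by (auto simp: cond_prob_def conj_ac)
  next
    case False
    then have "{\<omega>\<in>space M. (T \<omega> = x \<and> Y \<omega> = z) \<and> T \<omega> = y} = {}" "{\<omega>\<in>space M. T \<omega> = x \<and> T \<omega> = y} = {}"
      by auto
    then show ?thesis by (simp only: cond_prob_def measure_empty div_0 mult_zero_left)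
  qed
qed

lemma more_capable_if_less_noisy:
  assumes "less_noisy b K1 K2"
  shows "more_capable b K1 K2"
proof -
  have "mutual_info b M T Y1 \<le> mutual_info b M T Y2"
    if "prob_space M" and g: "generated_through M K1 T Y1" and "generated_through M K2 T Y2"
    for M :: "nat measure" and T Y1 Y2
  proof -
    have "simple_function M T" using g by (simp add: generated_through_def)
    then show ?thesis using assms that markov_chain_self[of M T] unfolding less_noisy_def by metis
  qed
  then show ?thesis using assms unfolding more_capable_def less_noisy_def by metis
qed

lemma degradation_supermodular_if_degraded:
  "degraded W V \<Longrightarrow> degradation_supermodular W V"
  unfolding degradation_supermodular_def by (intro exI[of _ "[]"]) simp

section \<open>Induced channels\<close>

text \<open>The index is valid even for values outside the list. This yields the pointwise range
  conditions of \<open>generated_through\<close>, although alphabets are exhausted only almost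
  surely.\<close>

lemma obtain_index:
  assumes "xs \<noteq> []"
  obtains f where "\<And>x. f x < length xs" "\<And>x. x \<in> set xs \<Longrightarrow> xs ! f x = x"
proof -
  have "\<forall>x. \<exists>k. k < length xs \<and> (x \<in> set xs \<longrightarrow> xs ! k = x)"
    using assms by (metis in_set_conv_nth length_greater_0_conv)
  then show ?thesis using that by metis
qed

lemma enumerates_alphabet_nonempty:
  assumes "prob_space M" "enumerates_alphabet M Y ys"
  shows "ys \<noteq> []"
proof
  assume "ys = []"
  then have "AE \<omega> in M. False" using assms(2) by (simp add: enumerates_alphabet_def)
  then show False using prob_space.AE_False[OF assms(1)] by simp
qed

text \<open>Only finitely many values are attained outside the support, each with probability
  zero.\<close>

lemma AE_enumerates_support:
  assumes M: "prob_space M" and T: "simple_function M T" and ts: "enumerates_support M T ts"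
  shows "AE \<omega> in M. T \<omega> \<in> set ts"
proof -
  interpret prob_space M by fact
  note T[measurable]
  have "AE \<omega> in M. \<forall>t\<in>T ` space M - set ts. T \<omega> \<noteq> t"
  proof (rule AE_finite_allI)
    show "finite (T ` space M - set ts)" using simple_functionD(1)[OF T] by simp
    fix t assume "t \<in> T ` space M - set ts"
    then have "\<P>(\<omega> in M. T \<omega> = t) = 0"
      using ts by (auto simp: enumerates_support_def zero_less_measure_iff)
    then show "AE \<omega> in M. T \<omega> \<noteq> t" by (subst (asm) prob_eq_0) auto
  qed
  then show ?thesis using AE_space by eventually_elim auto
qed

lemma enumerates_alphabet_support:
  assumes "prob_space M" "simple_function M T" "enumerates_support M T ts"
  shows "enumerates_alphabet M T ts"
  using assms AE_enumerates_support[OF assms]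
  by (simp add: enumerates_alphabet_def enumerates_support_def)

lemma prob_support_pos:
  "enumerates_support M T ts \<Longrightarrow> i < length ts \<Longrightarrow> 0 < \<P>(\<omega> in M. T \<omega> = ts ! i)"
  using nth_mem[of i ts] by (auto simp: enumerates_support_def)

lemma dim_induced_channel [simp]:
  "dim_row (induced_channel M T ts Y ys) = length ts"
  "dim_col (induced_channel M T ts Y ys) = length ys"
  by (auto simp: induced_channel_def)

lemma nonneg_induced_channel: "nonneg_mat (induced_channel M T ts Y ys)"
  by (simp add: nonneg_mat_def induced_channel_def cond_prob_def)

text \<open>Positions in a list of distinct symbols determine the symbols, so the events differ only
  where \<open>Z\<close> leaves its alphabet, a null set.\<close>

lemma prob_index:
  assumes M: "prob_space M" and Z: "simple_function M Z" and ys: "enumerates_alphabet M Z ys"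
    and T: "simple_function M T"
    and f: "\<And>x. x \<in> set ys \<Longrightarrow> f x < length ys \<and> ys ! f x = x" and j: "j < length ys"
  shows "\<P>(\<omega> in M. f (Z \<omega>) = j \<and> T \<omega> = t) = \<P>(\<omega> in M. Z \<omega> = ys ! j \<and> T \<omega> = t)"
    and "\<P>(\<omega> in M. f (Z \<omega>) = j) = \<P>(\<omega> in M. Z \<omega> = ys ! j)"
proof -
  interpret prob_space M by fact
  have fZ: "simple_function M (\<lambda>\<omega>. f (Z \<omega>))" by (rule simple_function_compose1[OF Z])
  note T[measurable] Z[measurable] fZ[measurable]
  have AE: "AE \<omega> in M. f (Z \<omega>) = j \<longleftrightarrow> Z \<omega> = ys ! j"
  proof -
    have "AE \<omega> in M. Z \<omega> \<in> set ys" using ys by (simp add: enumerates_alphabet_def)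
    then show ?thesis
    proof eventually_elim
      case (elim \<omega>)
      then show ?case using f[OF elim] ys j
        by (auto simp: enumerates_alphabet_def nth_eq_iff_index_eq)
    qed
  qed
  show "\<P>(\<omega> in M. f (Z \<omega>) = j \<and> T \<omega> = t) = \<P>(\<omega> in M. Z \<omega> = ys ! j \<and> T \<omega> = t)"
    "\<P>(\<omega> in M. f (Z \<omega>) = j) = \<P>(\<omega> in M. Z \<omega> = ys ! j)"
    by (rule prob_eq_AE; use AE in \<open>auto elim: eventually_mono\<close>)+
qed

text \<open>A function of the output is a deterministic post-processing. The identity, a constant
  and a coordinate projection as \<open>h\<close> give the three comparisons of the second and third
  axioms.\<close>

lemma degraded_induced_channel:
  assumes M: "prob_space M" and T: "simple_function M T"
    and Y: "simple_function M Y" and ys: "enumerates_alphabet M Y ys"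
    and Z: "simple_function M Z" and zs: "enumerates_alphabet M Z zs"
    and h: "AE \<omega> in M. Z \<omega> = h (Y \<omega>)"
  shows "degraded (induced_channel M T ts Z zs) (induced_channel M T ts Y ys)"
proof -
  interpret prob_space M by fact
  obtain f where f: "\<And>z. f z < length zs" "\<And>z. z \<in> set zs \<Longrightarrow> zs ! f z = z"
    using obtain_index[OF enumerates_alphabet_nonempty[OF M zs]] by blast
  \<comment> \<open>The 0/1 matrix of \<open>h\<close> in terms of indices. Where
    \<open>h (ys ! j)\<close> is not in \<open>zs\<close>, the totality of \<open>f\<close> still
    places exactly one 1 in the row.\<close>
  define KU where "KU = Matrix.mat (length ys) (length zs)
    (\<lambda>(j, l). if f (h (ys ! j)) = l then 1 else 0 :: real)"
  have dim: "dim_row KU = length ys" "dim_col KU = length zs" by (auto simp: KU_def)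
  have dist: "distinct ys" and AEy: "AE \<omega> in M. Y \<omega> \<in> set ys"
    using ys by (auto simp: enumerates_alphabet_def)
  note T[measurable] Y[measurable] Z[measurable]
  have fZ[measurable]: "simple_function M (\<lambda>\<omega>. f (Z \<omega>))"
    and hY[measurable]: "simple_function M (\<lambda>\<omega>. f (h (Y \<omega>)))"
    using simple_function_compose1[OF Z, of f] simple_function_compose1[OF Y, of "\<lambda>y. f (h y)"] by auto
  have "row_stochastic KU"
    using f(1) by (simp add: row_stochastic_def KU_def)
  moreover have "induced_channel M T ts Z zs = induced_channel M T ts Y ys * KU"
  proof (rule eq_matI)
    fix i l assume "i < dim_row (induced_channel M T ts Y ys * KU)"
      "l < dim_col (induced_channel M T ts Y ys * KU)"
    then have i: "i < length ts" and l: "l < length zs" by (auto simp: dim)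
    let ?t = "ts ! i"
    have "\<P>(\<omega> in M. Z \<omega> = zs ! l \<and> T \<omega> = ?t) = \<P>(\<omega> in M. f (Z \<omega>) = l \<and> T \<omega> = ?t)"
      using f l by (intro prob_index(1)[OF M Z zs T, symmetric]) auto
    \<comment> \<open>Here \<open>Z\<close> is replaced by \<open>h\<close> of \<open>Y\<close>,
      which is allowed up to a null set.\<close>
    also have "\<dots> = \<P>(\<omega> in M. T \<omega> = ?t \<and> f (h (Y \<omega>)) = l)"
      by (rule prob_eq_AE) (use h in \<open>auto elim: eventually_mono\<close>)
    also have "\<dots> = (\<Sum>y\<in>set ys. if f (h y) = l then \<P>(\<omega> in M. T \<omega> = ?t \<and> Y \<omega> = y) else 0)"
      by (rule prob_partition[OF M Y _ AEy]) auto
    also have "\<dots> = (\<Sum>j<length ys. if f (h (ys ! j)) = l then \<P>(\<omega> in M. T \<omega> = ?t \<and> Y \<omega> = ys ! j) else 0)"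
      by (rule sum.reindex_bij_betw[symmetric]) (rule bij_betw_nth[OF dist refl refl])
    finally have "cond_prob M (\<lambda>\<omega>. Z \<omega> = zs ! l) (\<lambda>\<omega>. T \<omega> = ?t)
        = (\<Sum>j<length ys. cond_prob M (\<lambda>\<omega>. Y \<omega> = ys ! j) (\<lambda>\<omega>. T \<omega> = ?t) * (if f (h (ys ! j)) = l then 1 else 0))"
      unfolding cond_prob_def
      by (simp add: sum_divide_distrib conj_commute if_distrib[of "\<lambda>x. x / _"] if_distrib[of "\<lambda>x. _ * x"] cong: if_cong)
    then show "induced_channel M T ts Z zs $$ (i, l) = (induced_channel M T ts Y ys * KU) $$ (i, l)"
      using i l by (simp add: times_mat_index_sum dim del: index_mult_mat(1)) (simp add: induced_channel_def KU_def)
  qed (auto simp: dim)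
  ultimately show ?thesis unfolding degraded_def using dim by auto
qed

section \<open>The first axiom for induced channels\<close>

lemma mutual_info_induced_channel:
  assumes M: "prob_space M" and b: "1 < b" and T: "simple_function M T" and ts: "enumerates_support M T ts"
    and Y: "simple_function M Y" and ys: "enumerates_alphabet M Y ys"
  shows "mutual_info b M Y T = channel_mi b (\<lambda>i. \<P>(\<omega> in M. T \<omega> = ts ! i)) (induced_channel M T ts Y ys)"
proof -
  have "mutual_info b M Y T = law_mi b (set ys) (set ts) (\<lambda>y t. \<P>(\<omega> in M. Y \<omega> = y \<and> T \<omega> = t))"
    using ys AE_enumerates_support[OF M T ts]
    by (intro mutual_info_eq_law_mi[OF M b Y T]) (auto simp: enumerates_alphabet_def)
  \<comment> \<open>Rows of a channel are inputs, so the input becomes the first argument.\<close>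
  also have "\<dots> = law_mi b (set ts) (set ys) (\<lambda>t y. \<P>(\<omega> in M. T \<omega> = t \<and> Y \<omega> = y))"
    by (subst law_mi_swap) (simp add: conj_commute)
  also have "\<dots> = law_mi b {..<length ts} {..<length ys} (\<lambda>i j. \<P>(\<omega> in M. T \<omega> = ts ! i \<and> Y \<omega> = ys ! j))"
    using ts ys by (intro law_mi_reindex[symmetric] bij_betw_nth)
      (auto simp: enumerates_support_def enumerates_alphabet_def)
  also have "\<dots> = channel_mi b (\<lambda>i. \<P>(\<omega> in M. T \<omega> = ts ! i)) (induced_channel M T ts Y ys)"
    unfolding channel_mi_def
  proof (rule law_mi_cong)
    fix i j
    assume "i \<in> {..<dim_row (induced_channel M T ts Y ys)}" "j \<in> {..<dim_col (induced_channel M T ts Y ys)}"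
    \<comment> \<open>Symbols of the support have positive probability, so the conditional
      probability in the matrix entry can be multiplied out.\<close>
    then show "\<P>(\<omega> in M. T \<omega> = ts ! i \<and> Y \<omega> = ys ! j)
        = \<P>(\<omega> in M. T \<omega> = ts ! i) * induced_channel M T ts Y ys $$ (i, j)"
      using prob_support_pos[OF ts, of i] by (simp add: induced_channel_def cond_prob_def conj_commute)
  qed auto
  finally show ?thesis .
qed

text \<open>Passing from symbols to their positions connects arbitrary alphabets to the definitions
  of the preorders, which see only index-valued variables.\<close>

lemma generated_through_induced_channel:
  assumes M: "prob_space M" and T: "simple_function M T" and ts: "enumerates_support M T ts"
    and Y: "simple_function M Y" and ys: "enumerates_alphabet M Y ys"
    and f: "\<And>x. f x < length ts" "\<And>x. x \<in> set ts \<Longrightarrow> ts ! f x = x"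
    and g: "\<And>x. g x < length ys" "\<And>x. x \<in> set ys \<Longrightarrow> ys ! g x = x"
  shows "generated_through M (induced_channel M T ts Y ys) (\<lambda>\<omega>. f (T \<omega>)) (\<lambda>\<omega>. g (Y \<omega>))"
proof -
  have ts': "enumerates_alphabet M T ts" by (rule enumerates_alphabet_support[OF M T ts])
  have fT: "simple_function M (\<lambda>\<omega>. f (T \<omega>))" and gY: "simple_function M (\<lambda>\<omega>. g (Y \<omega>))"
    using simple_function_compose1[OF T, of f] simple_function_compose1[OF Y, of g] by auto
  have "cond_prob M (\<lambda>\<omega>. g (Y \<omega>) = j) (\<lambda>\<omega>. f (T \<omega>) = i) = induced_channel M T ts Y ys $$ (i, j)"
    if ij: "i < length ts" "j < length ys" for i j
  proof -
    have "\<P>(\<omega> in M. g (Y \<omega>) = j \<and> f (T \<omega>) = i) = \<P>(\<omega> in M. Y \<omega> = ys ! j \<and> f (T \<omega>) = i)"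
      using g ij by (intro prob_index(1)[OF M Y ys fT]) auto
    also have "\<dots> = \<P>(\<omega> in M. Y \<omega> = ys ! j \<and> T \<omega> = ts ! i)"
      using f ij prob_index(1)[OF M T ts' Y, of f i "ys ! j"] by (auto simp: conj_commute)
    finally show ?thesis
      using ij f prob_index(2)[OF M T ts' T, of f i] by (simp add: cond_prob_def induced_channel_def)
  qed
  then show ?thesis using fT gY f g by (auto simp: generated_through_def)
qed

text \<open>
  Three variables are encoded into one natural number, so that the definition of the more capable
  preorder, which only sees sample spaces of type \<^typ>\<open>nat\<close>, applies to their joint law.
\<close>

lemma obtain_nat_sample_space:
  fixes X Y Z :: "'a \<Rightarrow> nat"
  assumes M: "prob_space M" and X: "simple_function M X" and Y: "simple_function M Y" and Z: "simple_function M Z"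
  obtains N :: "nat measure" and X' Y' Z' where "prob_space N"
    "\<And>t. \<P>(\<omega> in N. X' \<omega> = t) = \<P>(\<omega> in M. X \<omega> = t)"
    "\<And>K. generated_through M K X Y \<Longrightarrow> generated_through N K X' Y'"
    "\<And>K. generated_through M K X Z \<Longrightarrow> generated_through N K X' Z'"
proof -
  interpret prob_space M by fact
  define g where "g \<omega> = prod_encode (X \<omega>, prod_encode (Y \<omega>, Z \<omega>))" for \<omega>
  define N where "N = distr M (count_space (g ` space M)) g"
  have g: "simple_function M g"
    unfolding g_def[abs_def] by (intro simple_function_compose1[of M _ prod_encode] simple_function_Pair X Y Z)
  have meas: "g \<in> measurable M (count_space (g ` space M))"
    using measurable_simple_function[OF g] g by (auto simp: measurable_count_space_eq2 simple_functionD)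
  have N: "prob_space N" unfolding N_def by (rule prob_space_distr[OF meas])
  have space_N: "space N = g ` space M" and sets_N: "sets N = Pow (g ` space M)" by (auto simp: N_def)
  have fin: "finite (g ` space M)" by (rule simple_functionD(1)[OF g])
  \<comment> \<open>\<open>N\<close> lives on a finite set all of whose subsets are events, so every
    decoding function is admissible.\<close>
  have simple: "simple_function N (V :: nat \<Rightarrow> nat)" for V
    unfolding simple_function_def space_N sets_N using fin by auto
  have prob: "\<P>(\<omega> in N. Q \<omega>) = \<P>(\<omega> in M. Q (g \<omega>))" for Q
  proof -
    have "\<P>(\<omega> in N. Q \<omega>) = measure M (g -` {\<omega>\<in>g ` space M. Q \<omega>} \<inter> space M)"
      unfolding space_N by (unfold N_def, rule measure_distr[OF meas]) auto
    also have "g -` {\<omega>\<in>g ` space M. Q \<omega>} \<inter> space M = {\<omega>\<in>space M. Q (g \<omega>)}" by auto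
    finally show ?thesis .
  qed
  have transfer: "generated_through N K X' Y'"
    if "generated_through M K X V" and X': "\<And>\<omega>. X' (g \<omega>) = X \<omega>" and Y': "\<And>\<omega>. Y' (g \<omega>) = V \<omega>"
    for K X' Y' V
    using that(1) unfolding generated_through_def cond_prob_def prob X' Y'
    by (auto simp: simple space_N X' Y')
  show ?thesis
  proof (rule that[OF N])
    let ?X = "\<lambda>k. fst (prod_decode k)"
    show "\<P>(\<omega> in N. ?X \<omega> = t) = \<P>(\<omega> in M. X \<omega> = t)" for t
      unfolding prob by (simp add: g_def)
    show "generated_through N K ?X (\<lambda>k. fst (prod_decode (snd (prod_decode k))))"
      if "generated_through M K X Y" for K
      using that by (rule transfer) (simp_all add: g_def)
    show "generated_through N K ?X (\<lambda>k. snd (prod_decode (snd (prod_decode k))))"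
      if "generated_through M K X Z" for K
      using that by (rule transfer) (simp_all add: g_def)
  qed
qed

text \<open>The positions of the symbols are moved to a sample space of naturals, where the
  definition applies. Both mutual informations are values of \<open>channel_mi\<close> at the input
  law and the channel, so the inequality transfers back to \<open>M\<close>.\<close>

lemma mutual_info_le_if_more_capable:
  assumes M: "prob_space M" and b: "1 < b" and T: "simple_function M T" and ts: "enumerates_support M T ts"
    and Y: "simple_function M Y" and ys: "enumerates_alphabet M Y ys"
    and Z: "simple_function M Z" and zs: "enumerates_alphabet M Z zs"
    and mc: "more_capable b (induced_channel M T ts Y ys) (induced_channel M T ts Z zs)"
  shows "mutual_info b M Y T \<le> mutual_info b M Z T"
proof -
  have ts': "enumerates_alphabet M T ts" by (rule enumerates_alphabet_support[OF M T ts])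
  let ?KY = "induced_channel M T ts Y ys" and ?KZ = "induced_channel M T ts Z zs"
  obtain f where f: "\<And>x. f x < length ts" "\<And>x. x \<in> set ts \<Longrightarrow> ts ! f x = x"
    using obtain_index[OF enumerates_alphabet_nonempty[OF M ts']] by blast
  obtain g where g: "\<And>x. g x < length ys" "\<And>x. x \<in> set ys \<Longrightarrow> ys ! g x = x"
    using obtain_index[OF enumerates_alphabet_nonempty[OF M ys]] by blast
  obtain h where h: "\<And>x. h x < length zs" "\<And>x. x \<in> set zs \<Longrightarrow> zs ! h x = x"
    using obtain_index[OF enumerates_alphabet_nonempty[OF M zs]] by blast
  obtain N :: "nat measure" and T' Y' Z' where N: "prob_space N"
    and T': "\<And>t. \<P>(\<omega> in N. T' \<omega> = t) = \<P>(\<omega> in M. f (T \<omega>) = t)"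
    and Y': "\<And>K. generated_through M K (\<lambda>\<omega>. f (T \<omega>)) (\<lambda>\<omega>. g (Y \<omega>)) \<Longrightarrow> generated_through N K T' Y'"
    and Z': "\<And>K. generated_through M K (\<lambda>\<omega>. f (T \<omega>)) (\<lambda>\<omega>. h (Z \<omega>)) \<Longrightarrow> generated_through N K T' Z'"
    by (rule obtain_nat_sample_space[OF M simple_function_compose1[OF T, of f]
      simple_function_compose1[OF Y, of g] simple_function_compose1[OF Z, of h]]) (rule that)
  have gY: "generated_through N ?KY T' Y'"
    using f g by (intro Y' generated_through_induced_channel[OF M T ts Y ys]) auto
  have gZ: "generated_through N ?KZ T' Z'"
    using f h by (intro Z' generated_through_induced_channel[OF M T ts Z zs]) auto
  have p: "\<P>(\<omega> in N. T' \<omega> = t) = \<P>(\<omega> in M. T \<omega> = ts ! t)" if "t < length ts" for t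
    unfolding T' using f that by (intro prob_index(2)[OF M T ts' T]) auto
  have eq: "channel_mi b (\<lambda>t. \<P>(\<omega> in N. T' \<omega> = t)) K = channel_mi b (\<lambda>t. \<P>(\<omega> in M. T \<omega> = ts ! t)) K"
    if "dim_row K = length ts" for K
    unfolding channel_mi_def using that p by (intro law_mi_cong) auto
  have "mutual_info b N T' Y' \<le> mutual_info b N T' Z'"
    using mc N gY gZ unfolding more_capable_def by blast
  then show ?thesis
    by (simp add: mutual_info_generated_through[OF N b gY] mutual_info_generated_through[OF N b gZ] eq
      mutual_info_induced_channel[OF M b T ts Y ys] mutual_info_induced_channel[OF M b T ts Z zs])
qed

section \<open>Kolchinsky's axioms for the three preorders\<close>

theorem theorem2:
  fixes M :: "'a measure" and b :: real
    and T :: "'a \<Rightarrow> 't" and ts :: "'t list"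
    and n :: nat and Y :: "nat \<Rightarrow> 'a \<Rightarrow> 'y" and ys :: "nat \<Rightarrow> 'y list"
    and pre :: "real mat \<Rightarrow> real mat \<Rightarrow> bool"
  assumes "information_space M b"
    and "simple_function M T" and "enumerates_support M T ts"
    and "\<And>i. i \<in> {1..n} \<Longrightarrow> simple_function M (Y i)"
    and "\<And>i. i \<in> {1..n} \<Longrightarrow> enumerates_alphabet M (Y i) (ys i)"
    and "pre \<in> {less_noisy b, more_capable b, degradation_supermodular}"
  shows "(\<forall>i\<in>{1..n}. \<forall>j\<in>{1..n}.
           pre (induced_channel M T ts (Y i) (ys i)) (induced_channel M T ts (Y j) (ys j)) \<longrightarrow>
             mutual_info b M (Y i) T \<le> mutual_info b M (Y j) T) \<and>
         (\<forall>i\<in>{1..n}.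
           pre (induced_channel M T ts (Y i) (ys i)) (induced_channel M T ts (Y i) (ys i))) \<and>
         (\<forall>i\<in>{1..n}.
           (\<forall>(C :: 'a \<Rightarrow> 'c) c cs.
              simple_function M C \<and> (AE \<omega> in M. C \<omega> = c) \<and> enumerates_alphabet M C cs \<longrightarrow>
                pre (induced_channel M T ts C cs) (induced_channel M T ts (Y i) (ys i))) \<and>
           (\<forall>zs. enumerates_alphabet M (\<lambda>\<omega>. \<lambda>k\<in>{1..n}. Y k \<omega>) zs \<longrightarrow>
                pre (induced_channel M T ts (Y i) (ys i))
                    (induced_channel M T ts (\<lambda>\<omega>. \<lambda>k\<in>{1..n}. Y k \<omega>) zs)))"
proof -
  interpret information_space M b by fact
  have M: "prob_space M" by unfold_locales
  note T = assms(2) and ts = assms(3) and Y = assms(4) and ys = assms(5) and pre = assms(6)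
  let ?K = "\<lambda>i. induced_channel M T ts (Y i) (ys i)"
  let ?Z = "\<lambda>\<omega>. \<lambda>k\<in>{1..n}. Y k \<omega>"
  have degraded_pre: "pre W V" if "degraded W V" "nonneg_mat V" for W V
    using pre less_noisy_if_degraded[OF b_gt_1 that(2,1)] more_capable_if_less_noisy
      degradation_supermodular_if_degraded[OF that(1)] by auto
  have "mutual_info b M (Y i) T \<le> mutual_info b M (Y j) T"
    if i: "i \<in> {1..n}" and j: "j \<in> {1..n}" and ij: "pre (?K i) (?K j)" for i j
  proof (cases "pre = degradation_supermodular")
    case True
    then have "channel_mi b (\<lambda>t. \<P>(\<omega> in M. T \<omega> = ts ! t)) (?K i)
        \<le> channel_mi b (\<lambda>t. \<P>(\<omega> in M. T \<omega> = ts ! t)) (?K j)"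
      using ij by (intro channel_mi_degradation_supermodular[OF b_gt_1 _ nonneg_induced_channel]) auto
    then show ?thesis
      by (simp add: mutual_info_induced_channel[OF M b_gt_1 T ts Y[OF i] ys[OF i]]
        mutual_info_induced_channel[OF M b_gt_1 T ts Y[OF j] ys[OF j]])
  next
    \<comment> \<open>The two remaining preorders are treated together, since less noisy implies
      more capable.\<close>
    case False
    then have "more_capable b (?K i) (?K j)"
      using ij pre more_capable_if_less_noisy by auto
    then show ?thesis
      by (rule mutual_info_le_if_more_capable[OF M b_gt_1 T ts Y[OF i] ys[OF i] Y[OF j] ys[OF j]])
  qed
  moreover have "pre (?K i) (?K i)" if "i \<in> {1..n}" for i
    using that Y ys by (intro degraded_pre nonneg_induced_channel
      degraded_induced_channel[where h="\<lambda>y. y"] M T) auto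
  moreover have "pre (induced_channel M T ts C cs) (?K i)"
    if "i \<in> {1..n}" "simple_function M C" "AE \<omega> in M. C \<omega> = c" "enumerates_alphabet M C cs"
    for i and C :: "'a \<Rightarrow> 'c" and c cs
    \<comment> \<open>\<open>C\<close> is the constant function \<open>c\<close> of
      \<open>Y i\<close> only almost surely, which is all that
      \<open>degraded_induced_channel\<close> asks for.\<close>
    using that Y ys by (intro degraded_pre nonneg_induced_channel
      degraded_induced_channel[where h="\<lambda>_. c"] M T) auto
  moreover have "pre (?K i) (induced_channel M T ts ?Z zs)"
    if i: "i \<in> {1..n}" and zs: "enumerates_alphabet M ?Z zs" for i zs
  proof -
    have Z: "simple_function M ?Z"
      unfolding simple_function_def
    proof
      \<comment> \<open>Tuples are functions restricted to \<open>{1..n}\<close>, so they lie in an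
        extensional product of finite sets.\<close>
      have "?Z ` space M \<subseteq> (\<Pi>\<^sub>E k\<in>{1..n}. Y k ` space M)" by auto
      moreover have "finite (\<Pi>\<^sub>E k\<in>{1..n}. Y k ` space M)"
        using Y by (intro finite_PiE) (auto dest: simple_functionD(1))
      ultimately show "finite (?Z ` space M)" by (rule finite_subset)
      show "\<forall>z\<in>?Z ` space M. ?Z -` {z} \<inter> space M \<in> sets M"
      proof
        fix z assume "z \<in> ?Z ` space M"
        \<comment> \<open>Both tuples take the default value outside \<open>{1..n}\<close>, so
          equality is a finite conjunction over the coordinates.\<close>
        then have "?Z -` {z} \<inter> space M = {\<omega>\<in>space M. \<forall>k\<in>{1..n}. Y k \<omega> = z k}"
          by (auto simp: restrict_def fun_eq_iff) metis+
        also have "\<dots> \<in> sets M"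
          using events_eq[OF Y] by (intro sets.sets_Collect_finite_All) auto
        finally show "?Z -` {z} \<inter> space M \<in> sets M" .
      qed
    qed
    show ?thesis
      using i Y ys Z zs by (intro degraded_pre nonneg_induced_channel
        degraded_induced_channel[where h="\<lambda>z. z i"] M T) auto
  qed
  ultimately show ?thesis by blast
qed

end
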